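(* Let $M=\mathbb{R}^3$ with coordinates $(x,y,z)$, let $g_M=-dx^2+dy^2+dz^2$ be the three-dimensional Minkowski metric, let $$\rho(x,y,z)=\tfrac12x^2-\tfrac12y^2+x^3y+xy^3,$$ and let $g=e^{2\rho}g_M$. Then the curve $\gamma_0:[0,2\pi]\to M$, $\gamma_0(t)=\left(0,0,\tfrac{t}{\sqrt{\pi}}\right)$, is a geodesic of $(M,g)$ joining $(0,0,0)$ and $(0,0,2\sqrt{\pi})$, the point $\gamma_0(\pi^{3/2})=(0,0,\pi)$ is a conjugate point along $\gamma_0$, and there is no bifurcation point of geodesics on $\gamma_0$; in particular, the conjugate point $(0,0,\pi)$ is not a bifurcation point.
   Context: Let $(M,g)$ be a semi-Riemannian manifold with Levi-Civita connection $D$ and let $\gamma:[a,b]\to M$ be a geodesic, i.e. $\frac{D}{dt}\gamma'=0$. Conjugate point: for $t^\ast\in(a,b)$, the point $\gamma(t^\ast)$ is a conjugate point along $\gamma$ if there is a vector field $\xi$ along $\gamma$, not identically zero, which solves the Jacobi equation $\frac{D^2}{dt^2}\xi(t)+R(\gamma'(t),\xi(t))\gamma'(t)=0$ with $\xi(a)=0$ and $\xi(t^\ast)=0$. The sign convention for the curvature is $R(X,Y)Z=-D_XD_YZ+D_YD_XZ+D_{[X,Y]}Z$. Bifurcation point: for $t^\ast\in(a,b)$, the point $\gamma(t^\ast)$ is a bifurcation point (of geodesics) on $\gamma$ if there are a sequence $\{t_n\}_{n\in\mathbb{N}}\subset[a,b]$ converging to $t^\ast$ and geodesics $\gamma_n$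 of $(M,g)$, each defined on a subinterval of $[a,b]$ containing $a$ and $t_n$, such that (i) $\gamma_n(a)=\gamma(a)$ for all $n$; (ii) $\gamma_n(t_n)=\gamma(t_n)$ for all $n$; (iii) $\gamma_n'(a)\to\gamma'(a)$ in $T_{\gamma(a)}M$ as $n\to\infty$; (iv) none of the $\gamma_n$ is a restriction of $\gamma$ to a subinterval of $[a,b]$. *)

theory Defs
  imports "HOL-Analysis.Analysis"
begin

text \<open>
  Semi-Riemannian geometry on \<open>\<real>\<^sup>n\<close> in its standard global chart. All tangent spaces are identified
  with \<open>real ^ 'n\<close>, and a metric is given by its matrix field \<open>g p $ i $ j = g\<^sub>p(\<partial>\<^sub>i, \<partial>\<^sub>j)\<close>.
\<close>

type_synonym 'n metric = "real ^ 'n \<Rightarrow> real ^ 'n ^ 'n"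

section \<open>Levi-Civita connection and curvature\<close>

definition metric_partial :: "('n::finite) metric \<Rightarrow> real ^ 'n \<Rightarrow> 'n \<Rightarrow> 'n \<Rightarrow> 'n \<Rightarrow> real" where
  "metric_partial g p l i j = frechet_derivative (\<lambda>q. g q $ i $ j) (at p) (axis l 1)"

text \<open>\<open>christoffel g p k i j\<close> is \<open>\<Gamma>\<^sup>k\<^sub>i\<^sub>j(p)\<close>, the upper index coming first.\<close>

definition christoffel :: "('n::finite) metric \<Rightarrow> real ^ 'n \<Rightarrow> 'n \<Rightarrow> 'n \<Rightarrow> 'n \<Rightarrow> real" where
  "christoffel g p k i j =
     (1/2) * (\<Sum>l\<in>UNIV. matrix_inv (g p) $ k $ l *
        (metric_partial g p i j l + metric_partial g p j i l - metric_partial g p l i j))"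

definition christoffel_form :: "('n::finite) metric \<Rightarrow> real ^ 'n \<Rightarrow> real ^ 'n \<Rightarrow> real ^ 'n \<Rightarrow> real ^ 'n" where
  "christoffel_form g p u v = (\<chi> k. \<Sum>i\<in>UNIV. \<Sum>j\<in>UNIV. christoffel g p k i j * u $ i * v $ j)"

definition levi_civita ::
    "('n::finite) metric \<Rightarrow> (real ^ 'n \<Rightarrow> real ^ 'n) \<Rightarrow> (real ^ 'n \<Rightarrow> real ^ 'n) \<Rightarrow> real ^ 'n \<Rightarrow> real ^ 'n" where
  "levi_civita g X Y = (\<lambda>p. frechet_derivative Y (at p) (X p) + christoffel_form g p (X p) (Y p))"

definition lie_bracket ::
    "(real ^ 'n \<Rightarrow> real ^ 'n) \<Rightarrow> (real ^ 'n \<Rightarrow> real ^ 'n) \<Rightarrow> real ^ ('n::finite) \<Rightarrow> real ^ 'n" where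
  "lie_bracket X Y = (\<lambda>p. frechet_derivative Y (at p) (X p) - frechet_derivative X (at p) (Y p))"

text \<open>The sign is opposite to the convention \<open>R(X,Y)Z = D\<^sub>X D\<^sub>Y Z - D\<^sub>Y D\<^sub>X Z - D\<^bsub>[X,Y]\<^esub> Z\<close>.\<close>

definition curvature ::
    "('n::finite) metric \<Rightarrow> (real ^ 'n \<Rightarrow> real ^ 'n) \<Rightarrow> (real ^ 'n \<Rightarrow> real ^ 'n) \<Rightarrow> (real ^ 'n \<Rightarrow> real ^ 'n)
       \<Rightarrow> real ^ 'n \<Rightarrow> real ^ 'n" where
  "curvature g X Y Z = (\<lambda>p.
     - levi_civita g X (levi_civita g Y Z) p
     + levi_civita g Y (levi_civita g X Z) p
     + levi_civita g (lie_bracket X Y) Z p)"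

text \<open>
  Since \<open>R\<close> is tensorial, its value on tangent vectors at \<open>p\<close> may be computed from any vector fields
  extending them; we use the constant ones.
\<close>

definition curvature_at ::
    "('n::finite) metric \<Rightarrow> real ^ 'n \<Rightarrow> real ^ 'n \<Rightarrow> real ^ 'n \<Rightarrow> real ^ 'n \<Rightarrow> real ^ 'n" where
  "curvature_at g p u v w = curvature g (\<lambda>_. u) (\<lambda>_. v) (\<lambda>_. w) p"

section \<open>Geodesics, conjugate points and bifurcation points\<close>

text \<open>
  Curves, and vector fields along them, are total functions of which only the values on the parameter
  interval \<open>I\<close> matter: all derivatives are taken within \<open>I\<close>, hence are one-sided at its end points.
\<close>

definition smooth_curve_on :: "real set \<Rightarrow> (real \<Rightarrow> 'a::real_normed_vector) \<Rightarrow> bool" where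
  "smooth_curve_on I c \<longleftrightarrow>
     (\<exists>d :: nat \<Rightarrow> real \<Rightarrow> 'a. d 0 = c \<and>
        (\<forall>k. \<forall>t\<in>I. (d k has_vector_derivative d (Suc k) t) (at t within I)))"

definition velocity :: "real set \<Rightarrow> (real \<Rightarrow> 'a::real_normed_vector) \<Rightarrow> real \<Rightarrow> 'a" where
  "velocity I c t = vector_derivative c (at t within I)"

definition covariant_derivative_along ::
    "('n::finite) metric \<Rightarrow> real set \<Rightarrow> (real \<Rightarrow> real ^ 'n) \<Rightarrow> (real \<Rightarrow> real ^ 'n) \<Rightarrow> real \<Rightarrow> real ^ 'n" where
  "covariant_derivative_along g I c \<xi> t =
     vector_derivative \<xi> (at t within I) + christoffel_form g (c t) (velocity I c t) (\<xi> t)"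

text \<open>The parameter interval must not degenerate to a point, where velocities are meaningless.\<close>

definition geodesic_on :: "('n::finite) metric \<Rightarrow> real set \<Rightarrow> (real \<Rightarrow> real ^ 'n) \<Rightarrow> bool" where
  "geodesic_on g I c \<longleftrightarrow>
     is_interval I \<and> interior I \<noteq> {} \<and> smooth_curve_on I c \<and>
     (\<forall>t\<in>I. covariant_derivative_along g I c (velocity I c) t = 0)"

definition jacobi_field_on ::
    "('n::finite) metric \<Rightarrow> real set \<Rightarrow> (real \<Rightarrow> real ^ 'n) \<Rightarrow> (real \<Rightarrow> real ^ 'n) \<Rightarrow> bool" where
  "jacobi_field_on g I c \<xi> \<longleftrightarrow>
     smooth_curve_on I \<xi> \<and>
     (\<forall>t\<in>I. covariant_derivative_along g I c (covariant_derivative_along g I c \<xi>) t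
            + curvature_at g (c t) (velocity I c t) (\<xi> t) (velocity I c t) = 0)"

text \<open>The next two predicates express that \<open>c s\<close> is a conjugate, resp. bifurcation, point along \<open>c\<close>.\<close>

definition conjugate_point_along ::
    "('n::finite) metric \<Rightarrow> real \<Rightarrow> real \<Rightarrow> (real \<Rightarrow> real ^ 'n) \<Rightarrow> real \<Rightarrow> bool" where
  "conjugate_point_along g a b c s \<longleftrightarrow>
     s \<in> {a<..<b} \<and>
     (\<exists>\<xi>. jacobi_field_on g {a..b} c \<xi> \<and> (\<exists>t\<in>{a..b}. \<xi> t \<noteq> 0) \<and> \<xi> a = 0 \<and> \<xi> s = 0)"

definition bifurcation_point_on ::
    "('n::finite) metric \<Rightarrow> real \<Rightarrow> real \<Rightarrow> (real \<Rightarrow> real ^ 'n) \<Rightarrow> real \<Rightarrow> bool" where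
  "bifurcation_point_on g a b c s \<longleftrightarrow>
     s \<in> {a<..<b} \<and>
     (\<exists>(\<tau> :: nat \<Rightarrow> real) (I :: nat \<Rightarrow> real set) (\<sigma> :: nat \<Rightarrow> real \<Rightarrow> real ^ 'n).
        range \<tau> \<subseteq> {a..b} \<and> \<tau> \<longlonglongrightarrow> s \<and>
        (\<forall>n. I n \<subseteq> {a..b} \<and> a \<in> I n \<and> \<tau> n \<in> I n \<and> geodesic_on g (I n) (\<sigma> n)) \<and>
        (\<forall>n. \<sigma> n a = c a) \<and>
        (\<forall>n. \<sigma> n (\<tau> n) = c (\<tau> n)) \<and>
        (\<lambda>n. velocity (I n) (\<sigma> n) a) \<longlonglongrightarrow> velocity {a..b} c a \<and>
        (\<forall>n. \<not> (\<forall>t\<in>I n. \<sigma> n t = c t)))"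

section \<open>The conformally Minkowskian metric\<close>

definition minkowski3 :: "real ^ 3 ^ 3" where
  "minkowski3 = (\<chi> i j. if i = j then (if i = 1 then -1 else 1) else 0)"

definition rho :: "real ^ 3 \<Rightarrow> real" where
  "rho p = (let x = p $ 1; y = p $ 2 in (1/2) * x^2 - (1/2) * y^2 + x^3 * y + x * y^3)"

definition conformal_metric :: "3 metric" where
  "conformal_metric p = exp (2 * rho p) *\<^sub>R minkowski3"

definition gamma0 :: "real \<Rightarrow> real ^ 3" where
  "gamma0 t = vector [0, 0, t / sqrt pi]"

section \<open>Compatibility checks\<close>

lemma christoffel_torsion_free:
  assumes "\<And>q. transpose (g q) = g q"
  shows "christoffel g p k i j = christoffel g p k j i"
proof -
  have "g q $ a $ b = g q $ b $ a" for q a b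
    using assms[of q] by (metis transpose_def vec_lambda_beta)
  then have "metric_partial g p l a b = metric_partial g p l b a" for l a b
    by (simp add: metric_partial_def)
  then show ?thesis
    unfolding christoffel_def by (simp add: add.commute)
qed

lemma christoffel_metric_compatible:
  fixes g :: "('n::finite) metric"
  assumes sym: "\<And>q. transpose (g q) = g q" and inv: "invertible (g p)"
  shows "metric_partial g p k i j =
     (\<Sum>l\<in>UNIV. christoffel g p l k i * g p $ l $ j) + (\<Sum>l\<in>UNIV. christoffel g p l k j * g p $ i $ l)"
proof -
  have gs: "g q $ a $ b = g q $ b $ a" for q a b
    using sym[of q] by (metis transpose_def vec_lambda_beta)
  then have ps: "metric_partial g p l a b = metric_partial g p l b a" for l a b
    by (simp add: metric_partial_def)
  have right_inv: "g p ** matrix_inv (g p) = mat 1"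
    using someI_ex[OF inv[unfolded invertible_def]] unfolding matrix_inv_def by blast
  have unit: "(\<Sum>l\<in>UNIV. g p $ b $ l * matrix_inv (g p) $ l $ m) = (if b = m then 1 else 0)" for b m
    using arg_cong[OF right_inv, of "\<lambda>A. A $ b $ m"]
    by (simp add: matrix_matrix_mult_def mat_def)
  have lower: "(\<Sum>l\<in>UNIV. christoffel g p l k a * g p $ b $ l) =
      (1/2) * (metric_partial g p k a b + metric_partial g p a k b - metric_partial g p b k a)" for a b
  proof -
    define h where
      "h m = metric_partial g p k a m + metric_partial g p a k m - metric_partial g p m k a" for m
    have "(\<Sum>l\<in>UNIV. christoffel g p l k a * g p $ b $ l)
        = (1/2) * (\<Sum>l\<in>UNIV. \<Sum>m\<in>UNIV. g p $ b $ l * matrix_inv (g p) $ l $ m * h m)"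
      by (simp add: christoffel_def h_def sum_distrib_left sum_distrib_right mult_ac)
    also have "\<dots> = (1/2) * (\<Sum>m\<in>UNIV. (\<Sum>l\<in>UNIV. g p $ b $ l * matrix_inv (g p) $ l $ m) * h m)"
      by (subst sum.swap) (simp add: sum_distrib_right)
    also have "\<dots> = (1/2) * h b"
      by (simp add: unit if_distrib[of "\<lambda>x. x * _"] cong: if_cong)
    finally show ?thesis by (simp add: h_def)
  qed
  show ?thesis
    using lower[of i j] lower[of j i] gs ps by (simp add: field_simps)
qed

lemma conformal_metric_symmetric: "transpose (conformal_metric p) = conformal_metric p"
  by (simp add: conformal_metric_def minkowski3_def transpose_def vec_eq_iff)

lemma conformal_metric_nondegenerate: "invertible (conformal_metric p)"
  by (simp add: invertible_det_nz det_3 conformal_metric_def minkowski3_def)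

end

theory Submission
  imports Defs
begin

text \<open>
  Along a geodesic \<open>c = (x, y, z)\<close> of \<open>e\<^sup>2\<^sup>\<rho> g\<^sub>M\<close> write \<open>h\<close> for \<open>g\<^sub>M(c', c')\<close>. The geodesic equation reads
  \<open>x'' = - h \<rho>\<^sub>x - 2 \<rho>' x'\<close>, \<open>y'' = h \<rho>\<^sub>y - 2 \<rho>' y'\<close>, \<open>z'' = - 2 \<rho>' z'\<close>, where \<open>\<rho>'\<close> is the
  derivative of \<open>\<rho>\<close> along \<open>c\<close>. On the \<open>z\<close>-axis the gradient of \<open>\<rho>\<close> vanishes, so affinely
  parametrised axis segments are geodesics.

  Both quadratic terms of \<open>\<rho>\<close> linearise to the same oscillator \<open>\<xi>'' = - \<xi> / \<pi>\<close> in the \<open>x\<close>- and in the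
  \<open>y\<close>-direction: the sign of the metric compensates the sign of the quadratic term. Hence
  \<open>sin (t / sqrt \<pi>)\<close> in the \<open>x\<close>-direction is a Jacobi field, which vanishes at \<open>0\<close> and at
  \<open>\<pi> sqrt \<pi>\<close>.

  Bifurcation is excluded by the conformally weighted angular momentum
  \<open>W = e\<^sup>2\<^sup>\<rho> (y x' - x y')\<close>. In its derivative the quadratic terms of \<open>\<rho>\<close> cancel, and the quartic
  terms are chosen so that what remains is definite:
  \<open>W' = - E (x\<^sup>4 + 6 x\<^sup>2 y\<^sup>2 + y\<^sup>4)\<close>, with the conserved energy \<open>E = e\<^sup>2\<^sup>\<rho> h\<close>
  (\<open>energy_conserved\<close>, \<open>dmoment\<close>). A geodesic with initial velocity close to that of
  the axis is spacelike, so \<open>E > 0\<close> and \<open>W\<close> decreases. If it starts on the axis at time \<open>0\<close> and meets it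
  again at time \<open>T > 0\<close>, then \<open>W\<close> vanishes at both times, so \<open>W\<close> is constant and \<open>x = y = 0\<close> in
  between (\<open>on_axis_between\<close>). Uniqueness for the differential equation keeps the geodesic on the
  axis up to the end of its domain, beyond \<open>T\<close> as well (\<open>stays_on_axis\<close>); there it is affinely
  parametrised, and its positions at \<open>0\<close> and \<open>T\<close> identify it with the given curve (\<open>eq_gamma0\<close>).
\<close>

section \<open>The connection of the conformal metric\<close>

definition rho_x :: "real \<Rightarrow> real \<Rightarrow> real" where
  "rho_x x y = x + 3 * x^2 * y + y^3"

definition rho_y :: "real \<Rightarrow> real \<Rightarrow> real" where
  "rho_y x y = - y + x^3 + 3 * x * y^2"

definition drho :: "real ^ 3 \<Rightarrow> real ^ 3 \<Rightarrow> real" where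
  "drho p v = rho_x (p $ 1) (p $ 2) * v $ 1 + rho_y (p $ 1) (p $ 2) * v $ 2"

definition eta :: "real ^ 3 \<Rightarrow> real ^ 3 \<Rightarrow> real" where
  "eta u v = - (u $ 1 * v $ 1) + u $ 2 * v $ 2 + u $ 3 * v $ 3"

text \<open>
  The index is raised with the Minkowski metric, not with the conformal one: the factors
  \<open>e\<^sup>2\<^sup>\<rho>\<close> and \<open>e\<^sup>-\<^sup>2\<^sup>\<rho>\<close> cancel in the Christoffel symbols.
\<close>

definition grad_rho :: "real ^ 3 \<Rightarrow> real ^ 3" where
  "grad_rho p = vector [- rho_x (p $ 1) (p $ 2), rho_y (p $ 1) (p $ 2), 0]"

lemma has_derivative_rho: "(rho has_derivative drho p) (at p)"
  unfolding rho_def Let_def drho_def rho_x_def rho_y_def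
  by (rule has_derivative_eq_rhs, (rule derivative_intros bounded_linear.has_derivative[OF bounded_linear_vec_nth])+)
     (simp add: fun_eq_iff algebra_simps power2_eq_square power3_eq_cube)

lemma metric_partial_conformal:
  "metric_partial conformal_metric p l i j
     = 2 * exp (2 * rho p) * drho p (axis l 1) * minkowski3 $ i $ j"
proof -
  have "((\<lambda>q. conformal_metric q $ i $ j) has_derivative
      (\<lambda>v. 2 * exp (2 * rho p) * drho p v * minkowski3 $ i $ j)) (at p)"
    unfolding conformal_metric_def vector_scaleR_component real_scaleR_def
    by (rule has_derivative_eq_rhs, (rule derivative_intros has_derivative_rho)+)
       (simp add: fun_eq_iff algebra_simps)
  from frechet_derivative_at[OF this] show ?thesis
    unfolding metric_partial_def by metis
qed

lemma matrix_inv_conformal: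
  "matrix_inv (conformal_metric p) = exp (- 2 * rho p) *\<^sub>R minkowski3"
proof -
  let ?A = "conformal_metric p" and ?B = "exp (- 2 * rho p) *\<^sub>R minkowski3"
  have AB: "?A ** ?B = mat 1" and BA: "?B ** ?A = mat 1"
    by (auto simp: conformal_metric_def minkowski3_def matrix_matrix_mult_def mat_def vec_eq_iff
        sum_3 forall_3 exp_minus field_simps)
  show ?thesis
    unfolding matrix_inv_def
  proof (rule some_equality)
    show "?A ** ?B = mat 1 \<and> ?B ** ?A = mat 1" using AB BA by blast
    show "B = ?B" if "?A ** B = mat 1 \<and> B ** ?A = mat 1" for B
      using that AB by (metis matrix_mul_assoc matrix_mul_lid matrix_mul_rid)
  qed
qed

lemma christoffel_form_conformal:
  "christoffel_form conformal_metric p u v =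
     drho p u *\<^sub>R v + drho p v *\<^sub>R u - eta u v *\<^sub>R grad_rho p"
proof -
  have G: "christoffel conformal_metric p k i j =
     (\<Sum>l\<in>UNIV. minkowski3 $ k $ l * (drho p (axis i 1) * minkowski3 $ j $ l
        + drho p (axis j 1) * minkowski3 $ i $ l - drho p (axis l 1) * minkowski3 $ i $ j))" for k i j
    unfolding christoffel_def matrix_inv_conformal metric_partial_conformal sum_distrib_left
    by (rule sum.cong) (auto simp: exp_minus field_simps)
  show ?thesis
    unfolding christoffel_form_def G
    by (simp add: vec_eq_iff forall_3 sum_3 minkowski3_def drho_def eta_def grad_rho_def axis_def
        vector_3 algebra_simps)
qed

section \<open>Velocities and geodesics on an interval\<close>

lemma interval_at_within_nontrivial:
  fixes I :: "real set"
  assumes "is_interval I" "interior I \<noteq> {}" "t \<in> I"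
  shows "at t within I \<noteq> bot"
proof -
  have "I \<noteq> {x}" for x
    using assms(2) by auto
  then have "t islimpt I"
    using connected_imp_perfect assms(1,3) is_interval_connected_1 by metis
  then show ?thesis
    by (simp add: trivial_limit_within)
qed

lemma velocity_eq:
  assumes "is_interval I" "interior I \<noteq> {}" "t \<in> I"
    and "(c has_vector_derivative v) (at t within I)"
  shows "velocity I c t = v"
  unfolding velocity_def
  using vector_derivative_within interval_at_within_nontrivial assms by blast

lemma covariant_derivative_along_eq:
  assumes I: "is_interval I" "interior I \<noteq> {}" "t \<in> I"
    and c: "(c has_vector_derivative v) (at t within I)"
    and \<xi>: "(\<xi> has_vector_derivative w) (at t within I)"
  shows "covariant_derivative_along g I c \<xi> t = w + christoffel_form g (c t) v (\<xi> t)"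
  unfolding covariant_derivative_along_def velocity_eq[OF I c]
  using vector_derivative_within[OF interval_at_within_nontrivial[OF I] \<xi>] by simp

text \<open>
  Turns the geodesic condition into a first order system. The velocity is replaced by the derivative
  supplied by smoothness, since \<open>velocity I c\<close> is itself known to be differentiable only because it
  agrees with that derivative on \<open>I\<close>.
\<close>

lemma geodesic_onE:
  assumes "geodesic_on g I c"
  obtains v where
    "\<And>t. t \<in> I \<Longrightarrow> (c has_vector_derivative v t) (at t within I)"
    "\<And>t. t \<in> I \<Longrightarrow> (v has_vector_derivative - christoffel_form g (c t) (v t) (v t)) (at t within I)"
    "\<And>t. t \<in> I \<Longrightarrow> velocity I c t = v t"
proof -
  have I: "is_interval I" "interior I \<noteq> {}"
    and geo: "\<And>t. t \<in> I \<Longrightarrow> covariant_derivative_along g I c (velocity I c) t = 0"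
    using assms by (auto simp: geodesic_on_def)
  obtain d where "d 0 = c"
    and d: "\<And>k t. t \<in> I \<Longrightarrow> (d k has_vector_derivative d (Suc k) t) (at t within I)"
    using assms unfolding geodesic_on_def smooth_curve_on_def by blast
  then have c: "(c has_vector_derivative d 1 t) (at t within I)" if "t \<in> I" for t
    using d[of t 0] that by simp
  have vel: "velocity I c t = d 1 t" if "t \<in> I" for t
    using velocity_eq[OF I that c[OF that]] .
  have "(d 1 has_vector_derivative - christoffel_form g (c t) (d 1 t) (d 1 t)) (at t within I)"
    if t: "t \<in> I" for t
  proof -
    have "(velocity I c has_vector_derivative d (Suc 1) t) (at t within I)"
      by (rule has_vector_derivative_transform[OF t vel d[OF t]])
    from covariant_derivative_along_eq[OF I t c[OF t] this, of g] geo[OF t] vel[OF t]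
    have "d (Suc 1) t = - christoffel_form g (c t) (d 1 t) (d 1 t)"
      by (simp add: eq_neg_iff_add_eq_0)
    then show ?thesis using d[OF t, of 1] by simp
  qed
  with c vel show ?thesis using that by blast
qed

lemma derivative_zero_on_Icc:
  fixes f :: "real \<Rightarrow> real"
  assumes t: "t \<in> {0..T}" and "0 < T"
    and zero: "\<And>s. s \<in> {0..T} \<Longrightarrow> f s = 0"
    and d: "(f has_real_derivative d) (at t within {0..T})"
  shows "d = 0"
proof (rule vector_derivative_unique_within)
  show "at t within {0..T} \<noteq> bot"
    using assms(1,2) by (simp add: trivial_limit_within islimpt_Icc)
  show "(f has_vector_derivative d) (at t within {0..T})"
    using d by (simp add: has_real_derivative_iff_has_vector_derivative)
  show "(f has_vector_derivative 0) (at t within {0..T})"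
    by (rule has_vector_derivative_transform[OF t, of f "\<lambda>_. 0"]) (simp_all add: zero)
qed

text \<open>Gronwall's argument: \<open>e\<^sup>-\<^sup>C\<^sup>t u\<close> is nonincreasing, nonnegative and starts at \<open>0\<close>.\<close>

lemma gronwall_zero:
  fixes u :: "real \<Rightarrow> real"
  assumes "0 \<le> T"
    and der: "\<And>t. t \<in> {0..T} \<Longrightarrow> (u has_real_derivative u' t) (at t within {0..T})"
    and le: "\<And>t. t \<in> {0..T} \<Longrightarrow> u' t \<le> C * u t"
    and "u 0 = 0" "\<And>t. t \<in> {0..T} \<Longrightarrow> 0 \<le> u t"
  shows "u T = 0"
proof -
  define w where "w t = exp (- C * t) * u t" for t
  have w': "(w has_real_derivative exp (- C * t) * (u' t - C * u t)) (at t within {0..T})"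
    if "t \<in> {0..T}" for t
    unfolding w_def using that
    by (auto intro!: derivative_eq_intros der simp: algebra_simps)
  have "w T \<le> w 0"
  proof (rule DERIV_nonpos_imp_decreasing_open[OF \<open>0 \<le> T\<close>])
    show "continuous_on {0..T} w"
      using w' by (rule DERIV_continuous_on)
    fix t assume t: "0 < t" "t < T"
    then have "(w has_real_derivative exp (- C * t) * (u' t - C * u t)) (at t)"
      using w'[of t] by (simp add: at_within_Icc_at)
    moreover have "exp (- C * t) * (u' t - C * u t) \<le> 0"
      using le[of t] t by (intro mult_nonneg_nonpos) auto
    ultimately show "\<exists>y. (w has_real_derivative y) (at t) \<and> y \<le> 0" by blast
  qed
  then show ?thesis
    using assms(1,4) assms(5)[of T] by (auto simp: w_def mult_le_0_iff)
qed

section \<open>The geodesic equation of the conformal metric\<close>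

locale conformal_geodesic =
  fixes I :: "real set" and c v :: "real \<Rightarrow> real ^ 3"
  assumes interval: "is_interval I" "interior I \<noteq> {}"
    and c': "t \<in> I \<Longrightarrow> ((\<lambda>t. c t $ i) has_real_derivative v t $ i) (at t within I)"
    and v': "t \<in> I \<Longrightarrow> ((\<lambda>t. v t $ i) has_real_derivative
        eta (v t) (v t) * grad_rho (c t) $ i - 2 * drho (c t) (v t) * v t $ i) (at t within I)"

lemma geodesic_on_conformalE:
  assumes "geodesic_on conformal_metric I c"
  obtains v where "conformal_geodesic I c v" "\<And>t. t \<in> I \<Longrightarrow> velocity I c t = v t"
proof -
  obtain v where v:
    "\<And>t. t \<in> I \<Longrightarrow> (c has_vector_derivative v t) (at t within I)"
    "\<And>t. t \<in> I \<Longrightarrow> (v has_vector_derivative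
        - christoffel_form conformal_metric (c t) (v t) (v t)) (at t within I)"
    "\<And>t. t \<in> I \<Longrightarrow> velocity I c t = v t"
    using geodesic_onE[OF assms] by blast
  have comp: "((\<lambda>t. f t $ i) has_real_derivative f' $ i) (at t within I)"
    if "(f has_vector_derivative f') (at t within I)" for f :: "real \<Rightarrow> real ^ 3" and f' t i
    using bounded_linear.has_vector_derivative[OF bounded_linear_vec_nth[of i] that]
    by (simp add: has_real_derivative_iff_has_vector_derivative)
  have "conformal_geodesic I c v"
  proof
    show "is_interval I" "interior I \<noteq> {}"
      using assms by (auto simp: geodesic_on_def)
    fix t i assume t: "t \<in> I"
    show "((\<lambda>t. c t $ i) has_real_derivative v t $ i) (at t within I)"
      using comp[OF v(1)[OF t]] .
    show "((\<lambda>t. v t $ i) has_real_derivative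
        eta (v t) (v t) * grad_rho (c t) $ i - 2 * drho (c t) (v t) * v t $ i) (at t within I)"
      using comp[OF v(2)[OF t], of i]
      by (simp add: christoffel_form_conformal algebra_simps)
  qed
  then show ?thesis using that v(3) by blast
qed

context conformal_geodesic
begin

definition x :: "real \<Rightarrow> real" where "x t = c t $ 1"
definition y :: "real \<Rightarrow> real" where "y t = c t $ 2"
definition X :: "real \<Rightarrow> real" where "X t = v t $ 1"
definition Y :: "real \<Rightarrow> real" where "Y t = v t $ 2"
definition Z :: "real \<Rightarrow> real" where "Z t = v t $ 3"

definition speed2 :: "real \<Rightarrow> real" where
  "speed2 t = (Y t)^2 + (Z t)^2 - (X t)^2"

definition rho_rate :: "real \<Rightarrow> real" where
  "rho_rate t = rho_x (x t) (y t) * X t + rho_y (x t) (y t) * Y t"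

lemma component_derivatives:
  assumes "t \<in> I"
  shows dx: "(x has_real_derivative X t) (at t within I)"
    and dy: "(y has_real_derivative Y t) (at t within I)"
    and dX: "(X has_real_derivative - speed2 t * rho_x (x t) (y t) - 2 * rho_rate t * X t) (at t within I)"
    and dY: "(Y has_real_derivative speed2 t * rho_y (x t) (y t) - 2 * rho_rate t * Y t) (at t within I)"
    and dZ: "(Z has_real_derivative - 2 * rho_rate t * Z t) (at t within I)"
proof -
  have eqs: "eta (v t) (v t) = speed2 t" "drho (c t) (v t) = rho_rate t"
    "grad_rho (c t) $ 1 = - rho_x (x t) (y t)" "grad_rho (c t) $ 2 = rho_y (x t) (y t)"
    "grad_rho (c t) $ 3 = 0"
    by (simp_all add: eta_def speed2_def drho_def rho_rate_def grad_rho_def x_def y_def X_def Y_def Z_def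
        vector_3 power2_eq_square)
  have fold: "(\<lambda>t. c t $ 1) = x" "(\<lambda>t. c t $ 2) = y" "(\<lambda>t. v t $ 1) = X" "(\<lambda>t. v t $ 2) = Y"
    "(\<lambda>t. v t $ 3) = Z" "v t $ 1 = X t" "v t $ 2 = Y t" "v t $ 3 = Z t"
    by (simp_all add: fun_eq_iff x_def y_def X_def Y_def Z_def)
  show "(x has_real_derivative X t) (at t within I)" "(y has_real_derivative Y t) (at t within I)"
    using c'[OF assms, of 1] c'[OF assms, of 2] by (simp_all only: fold)
  show "(X has_real_derivative - speed2 t * rho_x (x t) (y t) - 2 * rho_rate t * X t) (at t within I)"
    "(Y has_real_derivative speed2 t * rho_y (x t) (y t) - 2 * rho_rate t * Y t) (at t within I)"
    "(Z has_real_derivative - 2 * rho_rate t * Z t) (at t within I)"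
    using v'[OF assms, of 1] v'[OF assms, of 2] v'[OF assms, of 3]
    unfolding fold eqs by simp_all
qed

lemma drho_along:
  assumes "t \<in> I"
  shows "((\<lambda>t. rho (c t)) has_real_derivative rho_rate t) (at t within I)"
proof -
  have rho_eq: "(\<lambda>t. rho (c t))
      = (\<lambda>t. (1/2) * (x t)^2 - (1/2) * (y t)^2 + (x t)^3 * y t + x t * (y t)^3)"
    by (simp add: fun_eq_iff rho_def x_def y_def Let_def)
  show ?thesis
    unfolding rho_eq
    by (rule derivative_eq_intros dx[OF assms] dy[OF assms] refl)+
       (simp add: rho_rate_def rho_x_def rho_y_def algebra_simps power2_eq_square power3_eq_cube)
qed

lemma sub_interval: "a \<in> I \<Longrightarrow> b \<in> I \<Longrightarrow> {a..b} \<subseteq> I"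
  using interval(1) by (meson atLeastAtMost_iff mem_is_interval_1_I subsetI)

lemma constant_on_interval:
  assumes "\<And>t. t \<in> I \<Longrightarrow> (f has_real_derivative 0) (at t within I)" "s \<in> I" "t \<in> I"
  shows "f s = f t"
  using has_field_derivative_zero_constant[of I f] interval(1) is_interval_convex assms by metis

text \<open>
  This is the constancy of \<open>g(c', c')\<close> along a geodesic; its sign is therefore decided by the initial
  velocity.
\<close>

lemma energy_conserved:
  assumes "s \<in> I" "t \<in> I"
  shows "exp (2 * rho (c s)) * speed2 s = exp (2 * rho (c t)) * speed2 t"
proof (rule constant_on_interval[OF _ assms])
  fix t assume t: "t \<in> I"
  have "(speed2 has_real_derivative - 2 * X t * (- speed2 t * rho_x (x t) (y t) - 2 * rho_rate t * X t)
      + 2 * Y t * (speed2 t * rho_y (x t) (y t) - 2 * rho_rate t * Y t) + 2 * Z t * (- 2 * rho_rate t * Z t))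
      (at t within I)"
    unfolding speed2_def[abs_def]
    by (rule derivative_eq_intros dX[OF t] dY[OF t] dZ[OF t] refl)+ (simp add: speed2_def algebra_simps)
  also have "- 2 * X t * (- speed2 t * rho_x (x t) (y t) - 2 * rho_rate t * X t)
      + 2 * Y t * (speed2 t * rho_y (x t) (y t) - 2 * rho_rate t * Y t) + 2 * Z t * (- 2 * rho_rate t * Z t)
      = 2 * speed2 t * rho_rate t - 4 * rho_rate t * speed2 t"
    by (simp add: rho_rate_def speed2_def) algebra
  finally show "((\<lambda>t. exp (2 * rho (c t)) * speed2 t) has_real_derivative 0) (at t within I)"
    by (auto intro!: derivative_eq_intros drho_along[OF t] simp: algebra_simps)
qed

text \<open>
  The angular momentum in the \<open>(x, y)\<close>-plane, weighted so that the friction terms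
  \<open>- 2 \<rho>' c'\<close> of the geodesic equation drop out of its derivative.
\<close>

definition moment :: "real \<Rightarrow> real" where
  "moment t = exp (2 * rho (c t)) * (y t * X t - x t * Y t)"

text \<open>
  The quartic is \<open>y \<rho>\<^sub>x + x \<rho>\<^sub>y\<close>: the contributions \<open>x y\<close> and \<open>- x y\<close> of the quadratic part of
  \<open>\<rho>\<close> cancel, so the derivative has a global sign and vanishes only on the axis.
\<close>

lemma dmoment:
  assumes t: "t \<in> I"
  shows "(moment has_real_derivative
      - (exp (2 * rho (c t)) * speed2 t) * ((x t)^4 + 6 * (x t)^2 * (y t)^2 + (y t)^4)) (at t within I)"
  unfolding moment_def[abs_def]
  by (rule derivative_eq_intros drho_along[OF t] dx[OF t] dy[OF t] dX[OF t] dY[OF t] refl)+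
     (simp add: rho_x_def rho_y_def algebra_simps power2_eq_square power3_eq_cube power4_eq_xxxx)

text \<open>
  No nontrivial spacelike geodesic leaves the axis and returns to it: the angular momentum vanishes
  at both ends but is monotone, with derivative zero only on the axis.
\<close>

lemma on_axis_between:
  assumes T: "0 \<in> I" "T \<in> I" "0 < T"
    and ends: "x 0 = 0" "y 0 = 0" "x T = 0" "y T = 0"
    and pos: "speed2 0 > 0" and t: "t \<in> {0..T}"
  shows "x t = 0 \<and> y t = 0"
proof -
  define E where "E = exp (2 * rho (c 0)) * speed2 0"
  define P where "P t = (x t)^4 + 6 * (x t)^2 * (y t)^2 + (y t)^4" for t
  have "E > 0" using pos by (simp add: E_def)
  have P0: "P t \<ge> 0" for t
    unfolding P_def by simp
  have W': "(moment has_real_derivative - E * P t) (at t within {0..T})" if "t \<in> {0..T}" for t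
  proof -
    have tI: "t \<in> I" using sub_interval[OF T(1,2)] that by blast
    show ?thesis
      using DERIV_subset[OF dmoment[OF tI] sub_interval[OF T(1,2)]] energy_conserved[OF tI T(1)]
      by (simp add: E_def P_def)
  qed
  have Wmono: "moment b \<le> moment a" if "0 \<le> a" "a \<le> b" "b \<le> T" for a b
  proof (rule DERIV_nonpos_imp_decreasing_open[OF \<open>a \<le> b\<close>])
    have "continuous_on {0..T} moment" using W' by (rule DERIV_continuous_on)
    then show "continuous_on {a..b} moment"
      using that by (auto elim: continuous_on_subset)
    fix t assume "a < t" "t < b"
    with that have t: "0 < t" "t < T" by auto
    then have "(moment has_real_derivative - E * P t) (at t)"
      using W'[of t] by (simp add: at_within_Icc_at)
    moreover have "- E * P t \<le> 0" using \<open>E > 0\<close> P0[of t] by simp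
    ultimately show "\<exists>y. (moment has_real_derivative y) (at t) \<and> y \<le> 0" by blast
  qed
  have "moment 0 = 0" "moment T = 0" using ends by (auto simp: moment_def)
  then have W0: "moment t = 0" if "t \<in> {0..T}" for t
    using Wmono[of 0 t] Wmono[of t T] that by auto
  have "- E * P t = 0"
    by (rule derivative_zero_on_Icc[OF t T(3) W0 W'[OF t]])
  then have "P t = 0" using \<open>E > 0\<close> by simp
  moreover have "(x t)^4 \<ge> 0" "6 * (x t)^2 * (y t)^2 \<ge> 0" "(y t)^4 \<ge> 0" by auto
  ultimately have "(x t)^4 = 0" "(y t)^4 = 0" unfolding P_def by linarith+
  then show ?thesis by simp
qed

text \<open>
  Uniqueness for the geodesic equation with initial data tangent to the axis. Since \<open>\<rho>\<^sub>x\<close> and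
  \<open>\<rho>\<^sub>y\<close> lie in the ideal generated by \<open>x\<close> and \<open>y\<close>, the system for \<open>(x, y, x', y')\<close> is linear with
  coefficients that are bounded on compact intervals, and the squared norm of the solution obeys a
  Gronwall inequality.
\<close>

lemma stays_on_axis:
  assumes I: "0 \<in> I" "I \<subseteq> {0..}" and S: "S \<in> I"
    and init: "x 0 = 0" "y 0 = 0" "X 0 = 0" "Y 0 = 0"
  shows "x S = 0 \<and> y S = 0"
proof -
  have "0 \<le> S" using I S by auto
  have sub: "{0..S} \<subseteq> I" by (rule sub_interval[OF I(1) S])
  have cont: "continuous_on {0..S} x" "continuous_on {0..S} y" "continuous_on {0..S} X"
    "continuous_on {0..S} Y" "continuous_on {0..S} Z"
    by (rule continuous_on_subset[OF DERIV_continuous_on sub], erule component_derivatives)+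
  \<comment> \<open>The coefficients come from \<open>\<rho>\<^sub>x = x (1 + 3 x y) + y y\<^sup>2\<close> and
      \<open>\<rho>\<^sub>y = - y (1 - 3 x y) + x x\<^sup>2\<close>.\<close>
  define k where "k t = \<bar>rho_rate t\<bar> + \<bar>speed2 t\<bar> * (2 + 6 * \<bar>x t * y t\<bar> + (x t)^2 + (y t)^2)" for t
  have "continuous_on {0..S} k"
    unfolding k_def[abs_def] speed2_def rho_rate_def rho_x_def rho_y_def by (intro continuous_intros cont)
  then have "bounded (k ` {0..S})"
    by (simp add: compact_continuous_image compact_imp_bounded)
  then obtain K where K: "\<And>t. t \<in> {0..S} \<Longrightarrow> k t \<le> K"
    by (metis bounded_real image_eqI abs_le_D1)
  define u where "u t = (x t)^2 + (y t)^2 + (X t)^2 + (Y t)^2" for t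
  define u' where "u' t = 2 * (x t * X t + y t * Y t)
    + 2 * X t * (- speed2 t * rho_x (x t) (y t) - 2 * rho_rate t * X t)
    + 2 * Y t * (speed2 t * rho_y (x t) (y t) - 2 * rho_rate t * Y t)" for t
  have "u S = 0"
  proof (rule gronwall_zero[OF \<open>0 \<le> S\<close>, where u' = u' and C = "1 + 4 * K"])
    fix t assume t: "t \<in> {0..S}"
    then have tI: "t \<in> I" using sub by blast
    have "(u has_real_derivative u' t) (at t within I)"
      unfolding u_def[abs_def] u'_def
      by (rule derivative_eq_intros dx[OF tI] dy[OF tI] dX[OF tI] dY[OF tI] refl)+
         (simp add: algebra_simps)
    then show "(u has_real_derivative u' t) (at t within {0..S})"
      using sub by (rule DERIV_subset)
    show "0 \<le> u t" unfolding u_def by simp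
    have amgm: "\<bar>2 * p * q\<bar> \<le> p^2 + q^2" for p q :: real
      using zero_le_power2[of "p - q"] zero_le_power2[of "p + q"]
      by (simp add: power2_eq_square algebra_simps abs_le_iff)
    have small: "\<bar>2 * x t * X t\<bar> \<le> u t" "\<bar>2 * y t * X t\<bar> \<le> u t"
      "\<bar>2 * x t * Y t\<bar> \<le> u t" "\<bar>2 * y t * Y t\<bar> \<le> u t"
      using amgm[of "x t" "X t"] amgm[of "y t" "X t"] amgm[of "x t" "Y t"] amgm[of "y t" "Y t"]
        zero_le_power2[of "x t"] zero_le_power2[of "y t"]
        zero_le_power2[of "X t"] zero_le_power2[of "Y t"]
      unfolding u_def by linarith+
    have term_le: "m * (p * (1 + 3 * a) + q * b) \<le> \<bar>m\<bar> * ((1 + 3 * \<bar>a\<bar>) + b) * U"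
      if "\<bar>p\<bar> \<le> U" "\<bar>q\<bar> \<le> U" "0 \<le> b" for m p q a b U :: real
    proof -
      have "\<bar>p * (1 + 3 * a)\<bar> \<le> U * (1 + 3 * \<bar>a\<bar>)"
        unfolding abs_mult using that by (intro mult_mono) auto
      moreover have "\<bar>q * b\<bar> \<le> U * b"
        unfolding abs_mult using that by (intro mult_mono) auto
      ultimately have "\<bar>p * (1 + 3 * a) + q * b\<bar> \<le> U * (1 + 3 * \<bar>a\<bar>) + U * b"
        by linarith
      then have "\<bar>m\<bar> * \<bar>p * (1 + 3 * a) + q * b\<bar> \<le> \<bar>m\<bar> * (U * (1 + 3 * \<bar>a\<bar>) + U * b)"
        by (rule mult_left_mono) simp
      moreover have "m * (p * (1 + 3 * a) + q * b) \<le> \<bar>m\<bar> * \<bar>p * (1 + 3 * a) + q * b\<bar>"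
        by (metis abs_ge_self abs_mult)
      ultimately show ?thesis by (simp add: algebra_simps)
    qed
    have "2 * X t * (- speed2 t * rho_x (x t) (y t))
        = - speed2 t * (2 * x t * X t * (1 + 3 * (x t * y t)) + 2 * y t * X t * (y t)^2)"
      by (simp add: rho_x_def algebra_simps power2_eq_square power3_eq_cube)
    also have "\<dots> \<le> \<bar>speed2 t\<bar> * ((1 + 3 * \<bar>x t * y t\<bar>) + (y t)^2) * u t"
      using term_le[of _ "u t" _ _ "- speed2 t"] small by simp
    finally have 1: "2 * X t * (- speed2 t * rho_x (x t) (y t))
        \<le> \<bar>speed2 t\<bar> * ((1 + 3 * \<bar>x t * y t\<bar>) + (y t)^2) * u t" .
    have "2 * Y t * (speed2 t * rho_y (x t) (y t))
        = speed2 t * ((- (2 * y t * Y t)) * (1 + 3 * (- (x t * y t))) + 2 * x t * Y t * (x t)^2)"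
      by (simp add: rho_y_def algebra_simps power2_eq_square power3_eq_cube)
    also have "\<dots> \<le> \<bar>speed2 t\<bar> * ((1 + 3 * \<bar>- (x t * y t)\<bar>) + (x t)^2) * u t"
      by (rule term_le) (use small in simp_all)
    finally have 2: "2 * Y t * (speed2 t * rho_y (x t) (y t))
        \<le> \<bar>speed2 t\<bar> * ((1 + 3 * \<bar>x t * y t\<bar>) + (x t)^2) * u t" by simp
    have "- rho_rate t * ((X t)^2 + (Y t)^2) \<le> \<bar>rho_rate t\<bar> * u t"
      by (rule mult_mono) (auto simp: u_def)
    then have 3: "- 4 * rho_rate t * ((X t)^2 + (Y t)^2) \<le> 4 * \<bar>rho_rate t\<bar> * u t" by linarith
    have 4: "2 * (x t * X t + y t * Y t) \<le> u t"
      using amgm[of "x t" "X t"] amgm[of "y t" "Y t"] unfolding u_def by (simp add: algebra_simps)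
    have "u' t = 2 * (x t * X t + y t * Y t) + 2 * X t * (- speed2 t * rho_x (x t) (y t))
        + 2 * Y t * (speed2 t * rho_y (x t) (y t)) - 4 * rho_rate t * ((X t)^2 + (Y t)^2)"
      by (simp add: u'_def algebra_simps power2_eq_square)
    also have "\<dots> \<le> u t + \<bar>speed2 t\<bar> * ((1 + 3 * \<bar>x t * y t\<bar>) + (y t)^2) * u t
        + \<bar>speed2 t\<bar> * ((1 + 3 * \<bar>x t * y t\<bar>) + (x t)^2) * u t + 4 * \<bar>rho_rate t\<bar> * u t"
      using 1 2 3 4 by linarith
    also have "\<dots> \<le> (1 + 4 * k t) * u t"
    proof -
      have "0 \<le> \<bar>speed2 t\<bar> * (2 + 6 * \<bar>x t * y t\<bar> + (x t)^2 + (y t)^2) * u t"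
        using \<open>0 \<le> u t\<close> by simp
      then show ?thesis by (simp add: k_def algebra_simps)
    qed
    also have "\<dots> \<le> (1 + 4 * K) * u t"
      using K[OF t] \<open>0 \<le> u t\<close> by (intro mult_right_mono) auto
    finally show "u' t \<le> (1 + 4 * K) * u t" .
  qed (auto simp: u_def init)
  then show ?thesis
    by (auto simp: u_def add_nonneg_eq_0_iff)
qed

text \<open>
  The geodesic may be defined beyond \<open>T\<close>, where the angular momentum argument says nothing. But being
  on the axis up to \<open>T\<close> forces its initial velocity to be tangent to the axis, and then uniqueness
  from time \<open>0\<close> covers the whole domain.
\<close>

lemma eq_gamma0:
  assumes I: "0 \<in> I" "T \<in> I" "0 < T" "I \<subseteq> {0..}"
    and ends: "c 0 = 0" "c T = gamma0 T"
    and pos: "eta (v 0) (v 0) > 0" and t: "t \<in> I"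
  shows "c t = gamma0 t"
proof -
  have ends': "x 0 = 0" "y 0 = 0" "x T = 0" "y T = 0"
    using ends by (auto simp: x_def y_def gamma0_def vector_3)
  have "speed2 0 > 0"
    using pos by (simp add: speed2_def X_def Y_def Z_def eta_def power2_eq_square)
  note between = on_axis_between[OF I(1-3) ends' this]
  have 0: "0 \<in> {0..T}" using I(3) by simp
  have X0: "X 0 = 0"
    by (rule derivative_zero_on_Icc[OF 0 I(3) _ DERIV_subset[OF dx[OF I(1)] sub_interval[OF I(1,2)]]])
       (use between in blast)
  have Y0: "Y 0 = 0"
    by (rule derivative_zero_on_Icc[OF 0 I(3) _ DERIV_subset[OF dy[OF I(1)] sub_interval[OF I(1,2)]]])
       (use between in blast)
  note axis = stays_on_axis[OF I(1,4) _ ends'(1,2) X0 Y0]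
  have "rho_rate s = 0" if "s \<in> I" for s
    using axis[OF that] by (simp add: rho_rate_def rho_x_def rho_y_def)
  then have "(Z has_real_derivative 0) (at s within I)" if "s \<in> I" for s
    using dZ[OF that] that by simp
  then have Z: "Z s = Z 0" if "s \<in> I" for s
    by (rule constant_on_interval[OF _ that I(1)])
  have "((\<lambda>t. c t $ 3 - Z 0 * t) has_real_derivative 0) (at s within I)" if "s \<in> I" for s
    using Z[OF that] by (auto intro!: derivative_eq_intros c'[OF that] simp: Z_def)
  then have z: "c s $ 3 = Z 0 * s" if "s \<in> I" for s
    using constant_on_interval[of "\<lambda>t. c t $ 3 - Z 0 * t", OF _ that I(1)] ends(1) by simp
  have "Z 0 * T = T / sqrt pi"
    using z[OF I(2)] ends(2) by (simp add: gamma0_def vector_3)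
  then have "c t $ 3 = t / sqrt pi"
    using z[OF t] I(3) by (simp add: field_simps)
  then show ?thesis
    using axis[OF t] by (simp add: vec_eq_iff forall_3 gamma0_def vector_3 x_def y_def)
qed

end

section \<open>The geodesic and its conjugate point\<close>

lemma axis_has_vector_derivative:
  assumes "(f has_real_derivative d) (at t within I)"
  shows "((\<lambda>t. axis i (f t) :: real ^ 'n) has_vector_derivative axis i d) (at t within I)"
proof -
  have "a *\<^sub>R axis i 1 = (axis i a :: real ^ 'n)" for a
    by (simp add: vec_eq_iff axis_def)
  moreover have "((\<lambda>t. f t *\<^sub>R axis i 1 :: real ^ 'n) has_vector_derivative d *\<^sub>R axis i 1) (at t within I)"
    using has_vector_derivative_scaleR[OF assms has_vector_derivative_const] by simp
  ultimately show ?thesis by simp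
qed

lemma gamma0_derivative:
  "(gamma0 has_vector_derivative axis 3 (1 / sqrt pi)) (at t within I)"
proof -
  have "gamma0 = (\<lambda>t. axis 3 (t / sqrt pi))"
    by (simp add: gamma0_def fun_eq_iff vec_eq_iff forall_3 vector_3 axis_def)
  moreover have "((\<lambda>t. t / sqrt pi) has_real_derivative 1 / sqrt pi) (at t within I)"
    using DERIV_cdivide[OF DERIV_ident] .
  ultimately show ?thesis
    using axis_has_vector_derivative by metis
qed

lemma christoffel_form_gamma0: "christoffel_form conformal_metric (gamma0 t) u v = 0"
  by (simp add: christoffel_form_conformal drho_def gamma0_def vector_3 rho_x_def rho_y_def
      grad_rho_def vec_eq_iff forall_3)

lemma interval_0_2pi: "is_interval {0..2 * pi}" "interior {0..2 * pi} \<noteq> {}"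
  by (auto simp: is_interval_cc not_le)

lemma velocity_gamma0:
  "t \<in> {0..2 * pi} \<Longrightarrow> velocity {0..2 * pi} gamma0 t = axis 3 (1 / sqrt pi)"
  by (rule velocity_eq[OF interval_0_2pi _ gamma0_derivative])

lemma geodesic_on_gamma0: "geodesic_on conformal_metric {0..2 * pi} gamma0"
proof -
  define d :: "nat \<Rightarrow> real \<Rightarrow> real ^ 3" where
    "d k = (if k = 0 then gamma0 else if k = 1 then (\<lambda>_. axis 3 (1 / sqrt pi)) else (\<lambda>_. 0))" for k
  have "(d k has_vector_derivative d (Suc k) t) (at t within {0..2 * pi})" for k t
    by (auto simp: d_def gamma0_derivative)
  then have "smooth_curve_on {0..2 * pi} gamma0"
    unfolding smooth_curve_on_def by (intro exI[of _ d]) (auto simp: d_def)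
  moreover have "covariant_derivative_along conformal_metric {0..2 * pi} gamma0
      (velocity {0..2 * pi} gamma0) t = 0" if t: "t \<in> {0..2 * pi}" for t
  proof -
    have "(velocity {0..2 * pi} gamma0 has_vector_derivative 0) (at t within {0..2 * pi})"
      by (rule has_vector_derivative_transform[OF t velocity_gamma0]) auto
    from covariant_derivative_along_eq[OF interval_0_2pi t gamma0_derivative this]
    show ?thesis by (simp add: christoffel_form_gamma0)
  qed
  ultimately show ?thesis
    unfolding geodesic_on_def using interval_0_2pi by auto
qed

lemma has_derivative_drho_gamma0:
  "((\<lambda>q. rho_x (q $ 1) (q $ 2)) has_derivative (\<lambda>v. v $ 1)) (at (gamma0 t))"
  "((\<lambda>q. rho_y (q $ 1) (q $ 2)) has_derivative (\<lambda>v. - v $ 2)) (at (gamma0 t))"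
  unfolding rho_x_def rho_y_def
  by (rule has_derivative_eq_rhs,
      (rule derivative_intros bounded_linear.has_derivative[OF bounded_linear_vec_nth])+,
      simp add: fun_eq_iff gamma0_def vector_3)+

text \<open>
  The Christoffel symbols vanish along the axis, so the curvature consists of their first
  derivatives only. Those in the axis direction vanish by translation invariance; what is left is
  the Hessian of \<open>\<rho>\<close>.
\<close>

lemma curvature_gamma0:
  "curvature_at conformal_metric (gamma0 t) (axis 3 a) (axis 1 b) (axis 3 a) = axis 1 (a^2 * b)"
proof -
  let ?\<Gamma> = "christoffel_form conformal_metric"
  have LC: "levi_civita conformal_metric (\<lambda>_. u) (\<lambda>_. w) = (\<lambda>q. ?\<Gamma> q u w)" for u w
    by (simp add: levi_civita_def fun_eq_iff)
  have LC0: "levi_civita conformal_metric X Y (gamma0 t)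
      = frechet_derivative Y (at (gamma0 t)) (X (gamma0 t))" for X Y
    by (simp add: levi_civita_def christoffel_form_gamma0)
  have \<Gamma>13: "(\<lambda>q. ?\<Gamma> q (axis 1 b) (axis 3 a)) = (\<lambda>q. (rho_x (q $ 1) (q $ 2) * b) *\<^sub>R axis 3 a)"
    by (simp add: fun_eq_iff christoffel_form_conformal drho_def eta_def axis_def)
  have "((\<lambda>q. ?\<Gamma> q (axis 1 b) (axis 3 a)) has_derivative (\<lambda>v. (v $ 1 * b) *\<^sub>R axis 3 a))
      (at (gamma0 t))"
    unfolding \<Gamma>13 by (intro derivative_intros has_derivative_drho_gamma0)
  note fd = fun_cong[OF frechet_derivative_at[OF this], symmetric]
  have 1: "frechet_derivative (\<lambda>q. ?\<Gamma> q (axis 1 b) (axis 3 a)) (at (gamma0 t)) (axis 3 a) = 0"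
    unfolding fd by (simp add: axis_def)
  have \<Gamma>33: "(\<lambda>q. ?\<Gamma> q (axis 3 a) (axis 3 a))
      = (\<lambda>q. (a^2 * rho_x (q $ 1) (q $ 2)) *\<^sub>R axis 1 1 + (- (a^2) * rho_y (q $ 1) (q $ 2)) *\<^sub>R axis 2 1)"
    by (simp add: fun_eq_iff christoffel_form_conformal drho_def eta_def axis_def grad_rho_def
        vec_eq_iff forall_3 vector_3 power2_eq_square)
  have "((\<lambda>q. ?\<Gamma> q (axis 3 a) (axis 3 a)) has_derivative
      (\<lambda>v. (a^2 * v $ 1) *\<^sub>R axis 1 1 + (- (a^2) * (- v $ 2)) *\<^sub>R axis 2 1)) (at (gamma0 t))"
    unfolding \<Gamma>33 by (intro derivative_intros has_derivative_drho_gamma0)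
  note fd = fun_cong[OF frechet_derivative_at[OF this], symmetric]
  have 2: "frechet_derivative (\<lambda>q. ?\<Gamma> q (axis 3 a) (axis 3 a)) (at (gamma0 t)) (axis 1 b)
      = axis 1 (a^2 * b)"
    unfolding fd by (simp add: axis_def vec_eq_iff forall_3)
  show ?thesis
    by (simp add: curvature_at_def curvature_def LC LC0 lie_bracket_def 1 2 frechet_derivative_const
        christoffel_form_gamma0)
qed

lemma jacobi_field_gamma0:
  "jacobi_field_on conformal_metric {0..2 * pi} gamma0 (\<lambda>t. axis 1 (sin (t / sqrt pi)))"
proof -
  let ?I = "{0..2 * pi}" and ?\<xi> = "\<lambda>t. axis 1 (sin (t / sqrt pi)) :: real ^ 3"
  let ?D = "covariant_derivative_along conformal_metric {0..2 * pi} gamma0"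
  \<comment> \<open>Each differentiation shifts the phase of the sine by \<open>\<pi> / 2\<close>.\<close>
  define d :: "nat \<Rightarrow> real \<Rightarrow> real ^ 3" where
    "d k t = axis 1 ((1 / sqrt pi)^k * sin (t / sqrt pi + real k * (pi / 2)))" for k t
  have "(d k has_vector_derivative d (Suc k) t) (at t within ?I)" for k t
    unfolding d_def[abs_def]
  proof (rule axis_has_vector_derivative)
    have "((\<lambda>t. t / sqrt pi + real k * (pi / 2)) has_real_derivative 1 / sqrt pi) (at t within ?I)"
      using DERIV_add[OF DERIV_cdivide[OF DERIV_ident] DERIV_const] by simp
    note sin' = DERIV_cmult[OF DERIV_chain2[OF DERIV_sin this], of "(1 / sqrt pi)^k"]
    have "sin (t / sqrt pi + real (Suc k) * (pi / 2)) = sin ((t / sqrt pi + real k * (pi / 2)) + pi / 2)"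
      by (simp add: algebra_simps add_divide_distrib)
    also have "\<dots> = cos (t / sqrt pi + real k * (pi / 2))"
      by (simp add: sin_add[of _ "pi / 2"])
    finally have "(1 / sqrt pi)^k * (cos (t / sqrt pi + real k * (pi / 2)) * (1 / sqrt pi))
        = (1 / sqrt pi)^Suc k * sin (t / sqrt pi + real (Suc k) * (pi / 2))" by simp
    with sin' show "((\<lambda>t. (1 / sqrt pi)^k * sin (t / sqrt pi + real k * (pi / 2))) has_real_derivative
        (1 / sqrt pi)^Suc k * sin (t / sqrt pi + real (Suc k) * (pi / 2))) (at t within ?I)"
      by simp
  qed
  then have smooth: "smooth_curve_on ?I ?\<xi>"
    unfolding smooth_curve_on_def by (intro exI[of _ d]) (auto simp: d_def)
  have arg: "((\<lambda>t. t / sqrt pi) has_real_derivative 1 / sqrt pi) (at t within ?I)" for t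
    using DERIV_cdivide[OF DERIV_ident] .
  have D1: "?D ?\<xi> t = axis 1 (cos (t / sqrt pi) / sqrt pi)" if t: "t \<in> ?I" for t
  proof -
    have "(?\<xi> has_vector_derivative axis 1 (cos (t / sqrt pi) / sqrt pi)) (at t within ?I)"
      by (rule axis_has_vector_derivative) (use DERIV_chain2[OF DERIV_sin arg] in simp)
    from covariant_derivative_along_eq[OF interval_0_2pi t gamma0_derivative this]
    show ?thesis by (simp add: christoffel_form_gamma0)
  qed
  have D2: "?D (?D ?\<xi>) t = axis 1 (- sin (t / sqrt pi) / pi)" if t: "t \<in> ?I" for t
  proof -
    have "((\<lambda>t. axis 1 (cos (t / sqrt pi) / sqrt pi)) has_vector_derivative
        (axis 1 (- sin (t / sqrt pi) / pi) :: real ^ 3)) (at t within ?I)"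
      by (rule axis_has_vector_derivative)
        (use DERIV_cdivide[OF DERIV_chain2[OF DERIV_cos arg], of "sqrt pi"] in simp)
    from has_vector_derivative_transform[OF t D1 this]
    have "(?D ?\<xi> has_vector_derivative axis 1 (- sin (t / sqrt pi) / pi)) (at t within ?I)" .
    from covariant_derivative_along_eq[OF interval_0_2pi t gamma0_derivative this]
    show ?thesis by (simp add: christoffel_form_gamma0)
  qed
  have "?D (?D ?\<xi>) t + curvature_at conformal_metric (gamma0 t) (velocity ?I gamma0 t) (?\<xi> t)
      (velocity ?I gamma0 t) = 0" if t: "t \<in> ?I" for t
    by (simp add: D2[OF t] velocity_gamma0[OF t] curvature_gamma0 power_divide)
       (simp add: vec_eq_iff axis_def)
  with smooth show ?thesis
    unfolding jacobi_field_on_def by blast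
qed

lemma pi_powr_three_halves: "pi powr (3/2) = pi * sqrt pi"
proof -
  have "pi powr (3/2) = pi powr (1 + 1/2)" by simp
  also have "\<dots> = pi * sqrt pi" unfolding powr_add by (simp add: powr_half_sqrt)
  finally show ?thesis .
qed

lemma conjugate_point_gamma0:
  "conjugate_point_along conformal_metric 0 (2 * pi) gamma0 (pi powr (3/2))"
  unfolding conjugate_point_along_def
proof (intro conjI exI[of _ "\<lambda>t. axis 1 (sin (t / sqrt pi)) :: real ^ 3"])
  have "sqrt pi < sqrt 4" by (rule real_sqrt_less_mono) (use pi_less_4 in simp)
  then show "pi powr (3/2) \<in> {0<..<2 * pi}"
    by (simp add: pi_powr_three_halves)
  have "sin ((sqrt pi * (pi / 2)) / sqrt pi) \<noteq> 0" by simp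
  moreover have "sqrt pi * (pi / 2) \<in> {0..2 * pi}"
    using \<open>sqrt pi < sqrt 4\<close> by simp
  ultimately show "\<exists>t\<in>{0..2 * pi}. axis 1 (sin (t / sqrt pi)) \<noteq> (0 :: real ^ 3)"
    by (metis axis_eq_0_iff)
qed (simp_all add: jacobi_field_gamma0 pi_powr_three_halves)

text \<open>
  Far enough in the sequence, the convergence of the initial velocities makes \<open>\<sigma> n\<close> spacelike and the
  convergence of \<open>\<tau>\<close> makes the meeting time \<open>\<tau> n\<close> positive. A single such \<open>n\<close> already gives the
  contradiction.
\<close>

lemma no_bifurcation_gamma0:
  "\<not> bifurcation_point_on conformal_metric 0 (2 * pi) gamma0 s"
proof
  assume bif: "bifurcation_point_on conformal_metric 0 (2 * pi) gamma0 s"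
  then have "0 < s" by (simp add: bifurcation_point_on_def)
  from bif obtain \<tau> I \<sigma> where \<tau>: "\<tau> \<longlonglongrightarrow> s"
    and all: "\<forall>n. I n \<subseteq> {0..2 * pi} \<and> 0 \<in> I n \<and> \<tau> n \<in> I n
      \<and> geodesic_on conformal_metric (I n) (\<sigma> n)"
    and ends: "\<forall>n. \<sigma> n 0 = gamma0 0" "\<forall>n. \<sigma> n (\<tau> n) = gamma0 (\<tau> n)"
    and vel: "(\<lambda>n. velocity (I n) (\<sigma> n) 0) \<longlonglongrightarrow> velocity {0..2 * pi} gamma0 0"
    and nontriv: "\<forall>n. \<not> (\<forall>t\<in>I n. \<sigma> n t = gamma0 t)"
    unfolding bifurcation_point_on_def by blast
  from all have I: "I n \<subseteq> {0..2 * pi}" "0 \<in> I n" "\<tau> n \<in> I n"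
    and geo: "geodesic_on conformal_metric (I n) (\<sigma> n)" for n
    by auto
  have "(\<lambda>n. eta (velocity (I n) (\<sigma> n) 0) (velocity (I n) (\<sigma> n) 0))
      \<longlonglongrightarrow> eta (axis 3 (1 / sqrt pi)) (axis 3 (1 / sqrt pi))"
    using vel unfolding eta_def velocity_gamma0[of 0, simplified]
    by (intro tendsto_intros)
  moreover have "eta (axis 3 (1 / sqrt pi)) (axis 3 (1 / sqrt pi)) > 0"
    by (simp add: eta_def axis_def)
  ultimately have "\<forall>\<^sub>F n in sequentially. eta (velocity (I n) (\<sigma> n) 0) (velocity (I n) (\<sigma> n) 0) > 0"
    by (rule order_tendstoD)
  moreover have "\<forall>\<^sub>F n in sequentially. \<tau> n > 0"
    using \<tau> \<open>0 < s\<close> by (rule order_tendstoD)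
  ultimately have "\<forall>\<^sub>F n in sequentially. eta (velocity (I n) (\<sigma> n) 0) (velocity (I n) (\<sigma> n) 0) > 0
      \<and> \<tau> n > 0"
    by (rule eventually_conj)
  then obtain n where n: "eta (velocity (I n) (\<sigma> n) 0) (velocity (I n) (\<sigma> n) 0) > 0" "\<tau> n > 0"
    using eventually_happens' sequentially_bot by blast
  obtain v where v: "conformal_geodesic (I n) (\<sigma> n) v"
    "\<And>t. t \<in> I n \<Longrightarrow> velocity (I n) (\<sigma> n) t = v t"
    using geodesic_on_conformalE[OF geo] by blast
  have "gamma0 0 = 0"
    by (simp add: gamma0_def vec_eq_iff forall_3 vector_3)
  then have "\<sigma> n 0 = 0" "\<sigma> n (\<tau> n) = gamma0 (\<tau> n)" using ends by simp_all
  moreover have "I n \<subseteq> {0..}" using I(1)[of n] by auto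
  moreover have "eta (v 0) (v 0) > 0" using n(1) v(2)[OF I(2)] by simp
  ultimately have "\<sigma> n t = gamma0 t" if "t \<in> I n" for t
    using conformal_geodesic.eq_gamma0[OF v(1) I(2,3) n(2)] that by blast
  then show False using nontriv by blast
qed

theorem mainTheorem1:
  shows "geodesic_on conformal_metric {0..2 * pi} gamma0 \<and>
    gamma0 0 = vector [0, 0, 0] \<and>
    gamma0 (2 * pi) = vector [0, 0, 2 * sqrt pi] \<and>
    gamma0 (pi powr (3/2)) = vector [0, 0, pi] \<and>
    conjugate_point_along conformal_metric 0 (2 * pi) gamma0 (pi powr (3/2)) \<and>
    (\<forall>s\<in>{0<..<2 * pi}. \<not> bifurcation_point_on conformal_metric 0 (2 * pi) gamma0 s) \<and>
    \<not> bifurcation_point_on conformal_metric 0 (2 * pi) gamma0 (pi powr (3/2))"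
proof -
  have "gamma0 (2 * pi) = vector [0, 0, 2 * sqrt pi]"
    by (simp add: gamma0_def real_div_sqrt flip: times_divide_eq_right)
  moreover have "gamma0 (pi powr (3/2)) = vector [0, 0, pi]"
    by (simp add: gamma0_def pi_powr_three_halves)
  moreover have "gamma0 0 = vector [0, 0, 0]"
    by (simp add: gamma0_def)
  ultimately show ?thesis
    using geodesic_on_gamma0 conjugate_point_gamma0 no_bifurcation_gamma0 by blast
qed

end
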